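(* Let $n\ge1$, $p,q>1$ with $q\ne2$, let $\Theta\subset\mathbb{R}^{n+1}$ be open and bounded, let $\xi_0\in\partial\Theta$ and $a>0$. Then $\xi_0$ is regular with respect to $\Theta$ for the equation $\partial_t u=\Delta_p^q u$ if and only if $\xi_0$ is regular with respect to $\Theta$ for the multiplied equation $a\,\partial_t u=\Delta_p^q u$.
   Context: Operator. Points of $\mathbb{R}^{n+1}$ are written $(x,t)$, and $\nabla$, $\Delta$, $D^2$ act in $x$ only. For $\nabla u\neq 0$, $\Delta_p^q u=|\nabla u|^{q-p}\operatorname{div}(|\nabla u|^{p-2}\nabla u)=F(\nabla u,D^2u)$ with $F(\eta,X)=|\eta|^{q-2}\operatorname{Tr}\big(X+(p-2)\tfrac{\eta\otimes\eta}{|\eta|^2}X\big)$ for $\eta\in\mathbb{R}^n\setminus\{0\}$ and $X$ a symmetric $n\times n$ matrix. Admissible functions. $\mathcal{F}(F)$ is the set of $f\in C^2([0,\infty))$ with $f(0)=f'(0)=f''(0)=0$, $f''(r)>0$ for all $r>0$, and $\lim_{x\to 0,\,x\ne 0}F(\nabla g(x),D^2g(x))=0$ for $g(x)=f(|x|)$. $\Sigma$ is the set of even $\sigma\in C^1(\mathbb{R})$ with $\sigma(0)=\sigma'(0)=0$ and $\sigma(r)>0$ for $r>0$. A function $\varphi\in C^2(\Theta)$ is admissible at $(x_0,t_0)\in\Theta$ if either $\nabla\varphi(x_0,t_0)\ne0$, or there are $\delta>0$, $f\in\mathcal{F}(F)$, $\sigma\in\Sigma$ such that $|\varphi(x,t)-\varphi(x_0,t_0)-\partial_t\varphi(x_0,t_0)(t-t_0)|\le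 f(|x-x_0|)+\sigma(t-t_0)$ for all $(x,t)\in B_\delta(x_0)\times(t_0-\delta,t_0+\delta)$. Viscosity supersolutions. For $a>0$, $u:\Theta\to\mathbb{R}\cup\{\infty\}$ is a viscosity supersolution of $a\,\partial_t u=\Delta_p^q u$ in $\Theta$ if (1) $u$ is lower semicontinuous; (2) $u$ is finite in a dense subset of $\Theta$; (3) whenever $\varphi\in C^2(\Theta)$ is admissible at $\xi\in\Theta$ and touches $u$ at $\xi$ from below (i.e. $\varphi(\xi)=u(\xi)$ and $\varphi<u$ in a punctured neighborhood of $\xi$), then $a\,\partial_t\varphi(\xi)-\Delta_p^q\varphi(\xi)\ge0$ if $\nabla\varphi(\xi)\ne0$, and $\partial_t\varphi(\xi)\ge0$ if $\nabla\varphi(\xi)=0$. The equation $\partial_tu=\Delta_p^qu$ is the case $a=1$. Perron solutions and regularity (for either equation). For bounded $f:\partial\Theta\to\mathbb{R}$, the upper class consists of the viscosity supersolutions $u$ of the equation in $\Theta$ that are bounded from below and satisfy $\liminf_{\Theta\ni\eta\to\xi}u(\eta)\ge f(\xi)$ for all $\xi\in\partial\Theta$; the upper Perron solution $\overline{H}f$ is the pointwise infimum in $\Theta$ over the upper class. A point $\xi_0\in\partial\Theta$ is regular for the equation if $\lim_{\Theta\ni\xi\to\xi_0}\overline{H}f(\xi)=f(\xi_0)$ for every $f\in C(\partial\Theta)$. *)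

theory Defs
  imports "HOL-Analysis.Analysis"
begin

text \<open>
  Points of $R^{n+1}$ are pairs of type \<open>(real^'n) \<times> real\<close>, so that $n = $ \<open>CARD('n)\<close> \<open>\<ge> 1\<close>.
  Functions on an open set are total functions of which only the values on that set matter.
\<close>

text \<open>Both smoothness notions are meant for open \<open>S\<close>.\<close>

definition C1_on :: "'a::euclidean_space set \<Rightarrow> ('a \<Rightarrow> real) \<Rightarrow> bool" where
  "C1_on S f \<longleftrightarrow> (\<forall>x\<in>S. f differentiable at x) \<and>
     (\<forall>v. continuous_on S (\<lambda>x. frechet_derivative f (at x) v))"

definition C2_on :: "'a::euclidean_space set \<Rightarrow> ('a \<Rightarrow> real) \<Rightarrow> bool" where
  "C2_on S f \<longleftrightarrow> C1_on S f \<and> (\<forall>v. C1_on S (\<lambda>x. frechet_derivative f (at x) v))"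

definition grad :: "(real^'n \<Rightarrow> real) \<Rightarrow> real^'n \<Rightarrow> real^'n" where
  "grad g x = (\<chi> i. frechet_derivative g (at x) (axis i 1))"

definition hess :: "(real^'n \<Rightarrow> real) \<Rightarrow> real^'n \<Rightarrow> real^'n^'n" where
  "hess g x = jacobian (grad g) (at x)"

definition grad_x :: "((real^'n) \<times> real \<Rightarrow> real) \<Rightarrow> (real^'n) \<times> real \<Rightarrow> real^'n" where
  "grad_x \<phi> \<xi> = grad (\<lambda>x. \<phi> (x, snd \<xi>)) (fst \<xi>)"

definition hess_x :: "((real^'n) \<times> real \<Rightarrow> real) \<Rightarrow> (real^'n) \<times> real \<Rightarrow> real^'n^'n" where
  "hess_x \<phi> \<xi> = hess (\<lambda>x. \<phi> (x, snd \<xi>)) (fst \<xi>)"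

definition deriv_t :: "((real^'n) \<times> real \<Rightarrow> real) \<Rightarrow> (real^'n) \<times> real \<Rightarrow> real" where
  "deriv_t \<phi> \<xi> = deriv (\<lambda>t. \<phi> (fst \<xi>, t)) (snd \<xi>)"

definition tensor_square :: "real^'n \<Rightarrow> real^'n^'n" where
  "tensor_square \<eta> = (\<chi> i j. \<eta> $ i * \<eta> $ j)"

text \<open>
  Expanding the divergence, $|\nabla u|^{q-p} \mathrm{div}(|\nabla u|^{p-2} \nabla u) = F(\nabla u, D^2 u)$
  where $\nabla u$ does not vanish; the value of \<open>F_pq\<close> at \<open>\<eta> = 0\<close> is never used.
\<close>

definition F_pq :: "real \<Rightarrow> real \<Rightarrow> real^'n \<Rightarrow> real^'n^'n \<Rightarrow> real" where
  "F_pq p q \<eta> X = norm \<eta> powr (q - 2) *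
     trace (X + (p - 2) *\<^sub>R (((1 / (norm \<eta>)\<^sup>2) *\<^sub>R tensor_square \<eta>) ** X))"

definition Delta_pq ::
    "real \<Rightarrow> real \<Rightarrow> ((real^'n) \<times> real \<Rightarrow> real) \<Rightarrow> (real^'n) \<times> real \<Rightarrow> real" where
  "Delta_pq p q \<phi> \<xi> = F_pq p q (grad_x \<phi> \<xi>) (hess_x \<phi> \<xi>)"

text \<open>
  The class $\mathcal F(F)$. The derivatives are one-sided at \<open>0\<close>, and \<open>f\<close> is unconstrained on
  the negative half-line. The type argument fixes the dimension in which the limit is taken.
\<close>

definition admissible_radial :: "'n::finite itself \<Rightarrow> real \<Rightarrow> real \<Rightarrow> (real \<Rightarrow> real) set" where
  "admissible_radial _ p q = {f. \<exists>f' f''.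
     (\<forall>r\<ge>0. (f has_real_derivative f' r) (at r within {0..})) \<and>
     (\<forall>r\<ge>0. (f' has_real_derivative f'' r) (at r within {0..})) \<and>
     continuous_on {0..} f'' \<and>
     f 0 = 0 \<and> f' 0 = 0 \<and> f'' 0 = 0 \<and> (\<forall>r>0. f'' r > 0) \<and>
     ((\<lambda>x::real^'n. F_pq p q (grad (\<lambda>y. f (norm y)) x) (hess (\<lambda>y. f (norm y)) x))
        \<longlongrightarrow> 0) (at 0)}"

definition admissible_time :: "(real \<Rightarrow> real) set" where
  "admissible_time = {\<sigma>. \<sigma> C1_differentiable_on UNIV \<and> (\<forall>r. \<sigma> (- r) = \<sigma> r) \<and>
     \<sigma> 0 = 0 \<and> deriv \<sigma> 0 = 0 \<and> (\<forall>r>0. \<sigma> r > 0)}"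

text \<open>The cylinder is required to lie in \<open>\<Theta>\<close>, since \<open>\<phi>\<close> is only given there.\<close>

definition admissible_at ::
    "real \<Rightarrow> real \<Rightarrow> ((real^'n) \<times> real) set \<Rightarrow> ((real^'n) \<times> real \<Rightarrow> real) \<Rightarrow> (real^'n) \<times> real \<Rightarrow> bool"
where
  "admissible_at p q \<Theta> \<phi> \<xi> \<longleftrightarrow> grad_x \<phi> \<xi> \<noteq> 0 \<or>
     (\<exists>\<delta>>0. \<exists>f\<in>admissible_radial TYPE('n) p q. \<exists>\<sigma>\<in>admissible_time.
        ball (fst \<xi>) \<delta> \<times> {snd \<xi> - \<delta><..<snd \<xi> + \<delta>} \<subseteq> \<Theta> \<and>
        (\<forall>x\<in>ball (fst \<xi>) \<delta>. \<forall>t\<in>{snd \<xi> - \<delta><..<snd \<xi> + \<delta>}.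
           \<bar>\<phi> (x, t) - \<phi> \<xi> - deriv_t \<phi> \<xi> * (t - snd \<xi>)\<bar>
             \<le> f (norm (x - fst \<xi>)) + \<sigma> (t - snd \<xi>)))"

definition lower_semicontinuous_on :: "'a::topological_space set \<Rightarrow> ('a \<Rightarrow> ereal) \<Rightarrow> bool" where
  "lower_semicontinuous_on S u \<longleftrightarrow> (\<forall>\<xi>\<in>S. u \<xi> \<le> Liminf (at \<xi> within S) u)"

definition touches_from_below ::
    "'a::topological_space set \<Rightarrow> ('a \<Rightarrow> real) \<Rightarrow> ('a \<Rightarrow> ereal) \<Rightarrow> 'a \<Rightarrow> bool" where
  "touches_from_below S \<phi> u \<xi> \<longleftrightarrow>
     ereal (\<phi> \<xi>) = u \<xi> \<and> eventually (\<lambda>\<eta>. ereal (\<phi> \<eta>) < u \<eta>) (at \<xi> within S)"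

text \<open>Viscosity supersolutions of \<open>a \<partial>\<^sub>t u = \<Delta>\<^sub>p\<^sup>q u\<close> in \<open>\<Theta>\<close>.\<close>

definition viscosity_supersolution ::
    "real \<Rightarrow> real \<Rightarrow> real \<Rightarrow> ((real^'n) \<times> real) set \<Rightarrow> ((real^'n) \<times> real \<Rightarrow> ereal) \<Rightarrow> bool" where
  "viscosity_supersolution a p q \<Theta> u \<longleftrightarrow>
     (\<forall>\<xi>\<in>\<Theta>. u \<xi> \<noteq> -\<infinity>) \<and>
     lower_semicontinuous_on \<Theta> u \<and>
     \<Theta> \<subseteq> closure {\<xi>\<in>\<Theta>. u \<xi> \<noteq> \<infinity>} \<and>
     (\<forall>\<phi>. \<forall>\<xi>\<in>\<Theta>. C2_on \<Theta> \<phi> \<and> admissible_at p q \<Theta> \<phi> \<xi> \<and> touches_from_below \<Theta> \<phi> u \<xi> \<longrightarrow>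
        (if grad_x \<phi> \<xi> \<noteq> 0 then a * deriv_t \<phi> \<xi> - Delta_pq p q \<phi> \<xi> \<ge> 0
         else deriv_t \<phi> \<xi> \<ge> 0))"

definition upper_class ::
    "real \<Rightarrow> real \<Rightarrow> real \<Rightarrow> ((real^'n) \<times> real) set \<Rightarrow> ((real^'n) \<times> real \<Rightarrow> real)
       \<Rightarrow> ((real^'n) \<times> real \<Rightarrow> ereal) set" where
  "upper_class a p q \<Theta> f = {u. viscosity_supersolution a p q \<Theta> u \<and>
     (\<exists>m::real. \<forall>\<xi>\<in>\<Theta>. ereal m \<le> u \<xi>) \<and>
     (\<forall>\<xi>\<in>frontier \<Theta>. Liminf (at \<xi> within \<Theta>) u \<ge> ereal (f \<xi>))}"

definition upper_perron ::
    "real \<Rightarrow> real \<Rightarrow> real \<Rightarrow> ((real^'n) \<times> real) set \<Rightarrow> ((real^'n) \<times> real \<Rightarrow> real)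
       \<Rightarrow> (real^'n) \<times> real \<Rightarrow> ereal" where
  "upper_perron a p q \<Theta> f \<xi> = (INF u\<in>upper_class a p q \<Theta> f. u \<xi>)"

text \<open>For bounded \<open>\<Theta>\<close> the frontier is compact, so the continuous boundary data are bounded.\<close>

definition regular_boundary_point ::
    "real \<Rightarrow> real \<Rightarrow> real \<Rightarrow> ((real^'n) \<times> real) set \<Rightarrow> (real^'n) \<times> real \<Rightarrow> bool" where
  "regular_boundary_point a p q \<Theta> \<xi>\<^sub>0 \<longleftrightarrow> \<xi>\<^sub>0 \<in> frontier \<Theta> \<and>
     (\<forall>f. continuous_on (frontier \<Theta>) f \<longrightarrow>
        (upper_perron a p q \<Theta> f \<longlongrightarrow> ereal (f \<xi>\<^sub>0)) (at \<xi>\<^sub>0 within \<Theta>))"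

end

theory Submission
  imports Defs
begin

text \<open>
  The operator $\Delta_p^q$ is homogeneous of degree $q - 1$, whereas $\partial_t$ is homogeneous of
  degree $1$. Hence $u \mapsto cu$ with $c > 0$ turns supersolutions of $a\,\partial_t u = \Delta_p^q u$
  into supersolutions of $a c^{q-2}\,\partial_t u = \Delta_p^q u$, and Perron solutions with boundary
  data $f$ into those with boundary data $cf$. As $q \neq 2$, the factor $c^{q-2}$ takes every
  positive value.
\<close>

section \<open>Scalar multiples and derivatives\<close>

text \<open>\<open>frechet_derivative\<close> is a choice operator, so its value says nothing at a
  point where no derivative exists. The factor is therefore pulled out under a differentiability
  hypothesis, and the facts built on it keep track of the set on which derivatives exist.\<close>

lemma frechet_derivative_cmult:
  fixes f :: "'a::real_normed_vector \<Rightarrow> real"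
  assumes "f differentiable at x"
  shows "frechet_derivative (\<lambda>y. c * f y) (at x) = (\<lambda>v. c * frechet_derivative f (at x) v)"
  using assms
  by (intro frechet_derivative_at[symmetric] has_derivative_mult_right)
    (simp add: frechet_derivative_works[symmetric])

lemma C1_on_cmult:
  assumes "C1_on S f"
  shows "C1_on S (\<lambda>x. c * f x)"
proof -
  have "continuous_on S (\<lambda>x. frechet_derivative (\<lambda>x. c * f x) (at x) v)" for v
  proof (rule continuous_on_eq)
    show "continuous_on S (\<lambda>x. c * frechet_derivative f (at x) v)"
      using assms by (auto simp: C1_on_def intro: continuous_intros)
  qed (use assms in \<open>simp add: C1_on_def frechet_derivative_cmult\<close>)
  then show ?thesis
    using assms by (auto simp: C1_on_def)
qed

text \<open>A derivative at a point of an open set depends only on the values in that set. This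
  serves \<open>C2_on_cmult\<close>, where the derivatives of \<open>c * f\<close> and
  \<open>f\<close> are known to be proportional on \<open>S\<close> only.\<close>

lemma C1_on_cong_open:
  assumes "C1_on S f" "open S" and eq: "\<And>x. x \<in> S \<Longrightarrow> f x = g x"
  shows "C1_on S g"
  unfolding C1_on_def
proof (intro conjI ballI allI)
  fix x assume "x \<in> S"
  then show "g differentiable at x"
    using assms has_derivative_transform_within_open[of f _ x UNIV S g]
    unfolding C1_on_def differentiable_def by blast
next
  fix v
  show "continuous_on S (\<lambda>x. frechet_derivative g (at x) v)"
  proof (rule continuous_on_eq)
    show "continuous_on S (\<lambda>x. frechet_derivative f (at x) v)"
      using assms by (simp add: C1_on_def)
    show "frechet_derivative f (at x) v = frechet_derivative g (at x) v" if "x \<in> S" for x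
      using assms that frechet_derivative_transform_within_open[of f x S g]
      by (auto simp: C1_on_def)
  qed
qed

lemma C2_on_cmult:
  assumes "C2_on S f" "open S"
  shows "C2_on S (\<lambda>x. c * f x)"
  unfolding C2_on_def
proof (intro conjI allI)
  show "C1_on S (\<lambda>x. c * f x)"
    using assms by (auto simp: C2_on_def intro: C1_on_cmult)
  fix v
  show "C1_on S (\<lambda>x. frechet_derivative (\<lambda>x. c * f x) (at x) v)"
  proof (rule C1_on_cong_open)
    show "C1_on S (\<lambda>x. c * frechet_derivative f (at x) v)"
      using assms by (auto simp: C2_on_def intro: C1_on_cmult)
  qed (use assms in \<open>simp_all add: C2_on_def C1_on_def frechet_derivative_cmult\<close>)
qed

lemma grad_cmult:
  assumes "g differentiable at x"
  shows "grad (\<lambda>y. c * g y) x = c *\<^sub>R grad g x"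
  by (simp add: grad_def frechet_derivative_cmult[OF assms] vec_eq_iff)

text \<open>The Hessian differentiates the function \<open>grad\<close>, so the factor has to come
  out of the gradient on a whole neighbourhood \<open>S\<close> of \<open>x\<close>, not just at
  \<open>x\<close>.\<close>

lemma hess_cmult:
  assumes "open S" "x \<in> S" and g: "\<And>y. y \<in> S \<Longrightarrow> g differentiable at y"
    and "grad g differentiable at x"
  shows "hess (\<lambda>y. c * g y) x = c *\<^sub>R hess g x"
proof -
  have "(grad g has_derivative frechet_derivative (grad g) (at x)) (at x)"
    using assms by (simp add: frechet_derivative_works[symmetric])
  then have "((\<lambda>y. c *\<^sub>R grad g y) has_derivative
      (\<lambda>v. c *\<^sub>R frechet_derivative (grad g) (at x) v)) (at x)"
    by (rule has_derivative_scaleR_right)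
  then have "(grad (\<lambda>y. c * g y) has_derivative
      (\<lambda>v. c *\<^sub>R frechet_derivative (grad g) (at x) v)) (at x)"
    by (rule has_derivative_transform_within_open[OF _ assms(1,2)]) (simp add: grad_cmult g)
  from frechet_derivative_at[OF this] show ?thesis
    by (simp add: hess_def jacobian_def matrix_def vec_eq_iff fun_eq_iff)
qed

section \<open>Homogeneity of the operator\<close>

lemma trace_scaleR: "trace (c *\<^sub>R A) = c * trace A" for A :: "real^'n^'n"
  by (simp add: trace_def sum_distrib_left)

text \<open>The matrix \<eta> \<otimes> \<eta> / |\<eta>|^2 is invariant under positive scaling, so
  the trace contributes one factor \<open>c\<close> through \<open>X\<close> and the power of the
  norm contributes \<open>c powr (q - 2)\<close>. At \<eta> = 0 both sides are 0, because
  \<open>0 powr r = 0\<close>.\<close>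

lemma F_pq_homogeneous:
  assumes "c > 0"
  shows "F_pq p q (c *\<^sub>R \<eta>) (c *\<^sub>R X) = c powr (q - 1) * F_pq p q \<eta> X"
proof -
  have t: "(1 / (norm (c *\<^sub>R \<eta>))\<^sup>2) *\<^sub>R tensor_square (c *\<^sub>R \<eta>)
      = (1 / (norm \<eta>)\<^sup>2) *\<^sub>R tensor_square \<eta>"
    using assms by (simp add: tensor_square_def vec_eq_iff power2_eq_square)
  have "c *\<^sub>R X + (p - 2) *\<^sub>R (M ** (c *\<^sub>R X)) = c *\<^sub>R (X + (p - 2) *\<^sub>R (M ** X))" for M
    by (simp add: matrix_matrix_mult_def vec_eq_iff sum_distrib_left algebra_simps)
  moreover have "c powr (q - 1) = c powr (q - 2) * c"
    using assms powr_add[of c "q - 2" 1] by simp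
  ultimately show ?thesis
    using assms unfolding F_pq_def t by (simp add: trace_scaleR powr_mult)
qed

section \<open>Scaling of test functions\<close>

text \<open>Chain rule along the embedding \<open>y\<close> to \<open>(y, t)\<close>. It links
  \<open>grad_x\<close> and \<open>hess_x\<close>, which are defined by freezing the time, with
  \<open>C2_on\<close>, which concerns joint derivatives.\<close>

lemma differentiable_slice_x:
  fixes \<phi> :: "'a::real_normed_vector \<times> 'b::real_normed_vector \<Rightarrow> 'c::real_normed_vector"
  assumes "\<phi> differentiable at (x, t)"
  shows "(\<lambda>y. \<phi> (y, t)) differentiable at x"
    and "frechet_derivative (\<lambda>y. \<phi> (y, t)) (at x) v = frechet_derivative \<phi> (at (x, t)) (v, 0)"
proof -
  have "((\<lambda>y. \<phi> (y, t)) has_derivative (\<lambda>v. frechet_derivative \<phi> (at (x, t)) (v, 0))) (at x)"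
    by (rule has_derivative_compose[of "\<lambda>y. (y, t)"])
      (use assms in \<open>auto intro!: derivative_eq_intros simp: frechet_derivative_works[symmetric]\<close>)
  then show "(\<lambda>y. \<phi> (y, t)) differentiable at x"
    and "frechet_derivative (\<lambda>y. \<phi> (y, t)) (at x) v = frechet_derivative \<phi> (at (x, t)) (v, 0)"
    by (auto simp: differentiable_def simp flip: frechet_derivative_at)
qed

lemma differentiable_slice_t:
  fixes \<phi> :: "'a::real_normed_vector \<times> 'b::real_normed_vector \<Rightarrow> 'c::real_normed_vector"
  assumes "\<phi> differentiable at (x, t)"
  shows "(\<lambda>s. \<phi> (x, s)) differentiable at t"
proof -
  have "((\<lambda>s. \<phi> (x, s)) has_derivative (\<lambda>v. frechet_derivative \<phi> (at (x, t)) (0, v))) (at t)"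
    by (rule has_derivative_compose[of "\<lambda>s. (x, s)"])
      (use assms in \<open>auto intro!: derivative_eq_intros simp: frechet_derivative_works[symmetric]\<close>)
  then show ?thesis
    by (auto simp: differentiable_def)
qed

lemma differentiable_vec_lambda:
  fixes g :: "'a::real_normed_vector \<Rightarrow> real^'n"
  assumes "\<And>i. (\<lambda>y. g y $ i) differentiable at x"
  shows "g differentiable at x"
proof -
  have "\<forall>i. \<exists>D. ((\<lambda>y. g y $ i) has_derivative D) (at x)"
    using assms by (simp add: differentiable_def)
  then obtain D where "\<And>i. ((\<lambda>y. g y $ i) has_derivative D i) (at x)"
    by metis
  then have "(g has_derivative (\<lambda>v. \<chi> i. D i v)) (at x)"
    by (subst has_derivative_componentwise_within)
      (auto simp: Basis_vec_def inner_axis)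
  then show ?thesis
    by (auto simp: differentiable_def)
qed

lemma
  fixes \<phi> :: "(real^'n) \<times> real \<Rightarrow> real"
  assumes \<phi>: "C2_on \<Theta> \<phi>" and "open \<Theta>" and \<xi>: "\<xi> \<in> \<Theta>"
  shows grad_x_cmult: "grad_x (\<lambda>\<eta>. c * \<phi> \<eta>) \<xi> = c *\<^sub>R grad_x \<phi> \<xi>"
    and hess_x_cmult: "hess_x (\<lambda>\<eta>. c * \<phi> \<eta>) \<xi> = c *\<^sub>R hess_x \<phi> \<xi>"
    and deriv_t_cmult: "deriv_t (\<lambda>\<eta>. c * \<phi> \<eta>) \<xi> = c * deriv_t \<phi> \<xi>"
proof -
  obtain x t where xt: "\<xi> = (x, t)" by (cases \<xi>)
  \<comment> \<open>The time slice of \<Theta> through \<xi> is an open neighbourhood of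
    \<open>x\<close>, as \<open>hess_cmult\<close> requires.\<close>
  let ?S = "{y. (y, t) \<in> \<Theta>}"
  have S: "open ?S" "x \<in> ?S"
    using \<xi> xt open_vimage[OF \<open>open \<Theta>\<close>, of "\<lambda>y. (y, t)"]
    by (auto simp: vimage_def continuous_on_Pair)
  have diff: "\<phi> differentiable at \<eta>" if "\<eta> \<in> \<Theta>" for \<eta>
    using \<phi> that by (simp add: C2_on_def C1_on_def)
  have diff': "(\<lambda>\<eta>. frechet_derivative \<phi> (at \<eta>) v) differentiable at \<eta>" if "\<eta> \<in> \<Theta>" for \<eta> v
    using \<phi> that unfolding C2_on_def C1_on_def by blast
  have slice: "(\<lambda>y. \<phi> (y, t)) differentiable at y" if "y \<in> ?S" for y
    using diff that by (auto intro: differentiable_slice_x)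
  show "grad_x (\<lambda>\<eta>. c * \<phi> \<eta>) \<xi> = c *\<^sub>R grad_x \<phi> \<xi>"
    using slice S by (simp add: grad_x_def xt grad_cmult)
  \<comment> \<open>On the slice, component \<open>i\<close> of the spatial gradient is the joint
    derivative of \<phi> in the direction \<open>(axis i 1, 0)\<close>, which is differentiable
    because \<phi> is C^2.\<close>
  have "(\<lambda>y. grad (\<lambda>y. \<phi> (y, t)) y $ i) differentiable at x" for i
  proof -
    have "(\<lambda>y. frechet_derivative \<phi> (at (y, t)) (axis i 1, 0)) differentiable at x"
      using diff'[OF \<xi>] by (auto simp: xt intro: differentiable_slice_x(1))
    then obtain D where "((\<lambda>y. frechet_derivative \<phi> (at (y, t)) (axis i 1, 0)) has_derivative D) (at x)"
      by (auto simp: differentiable_def)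
    then have "((\<lambda>y. grad (\<lambda>y. \<phi> (y, t)) y $ i) has_derivative D) (at x)"
      by (rule has_derivative_transform_within_open[OF _ S])
        (simp add: grad_def differentiable_slice_x(2) diff)
    then show ?thesis
      by (auto simp: differentiable_def)
  qed
  then have "grad (\<lambda>y. \<phi> (y, t)) differentiable at x"
    by (rule differentiable_vec_lambda)
  then show "hess_x (\<lambda>\<eta>. c * \<phi> \<eta>) \<xi> = c *\<^sub>R hess_x \<phi> \<xi>"
    using hess_cmult[OF S slice] by (simp add: hess_x_def xt)
  have "(\<lambda>s. \<phi> (x, s)) field_differentiable at t"
    using differentiable_slice_t[of \<phi> x t] diff[OF \<xi>] xt
    by (simp add: real_differentiable_def field_differentiable_def)
  then show "deriv_t (\<lambda>\<eta>. c * \<phi> \<eta>) \<xi> = c * deriv_t \<phi> \<xi>"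
    by (simp add: deriv_t_def xt)
qed

lemma Delta_pq_cmult:
  assumes "C2_on \<Theta> \<phi>" "open \<Theta>" "\<xi> \<in> \<Theta>" "c > 0"
  shows "Delta_pq p q (\<lambda>\<eta>. c * \<phi> \<eta>) \<xi> = c powr (q - 1) * Delta_pq p q \<phi> \<xi>"
  using assms by (simp add: Delta_pq_def grad_x_cmult hess_x_cmult F_pq_homogeneous)

section \<open>Comparison functions in space and time\<close>

lemma
  fixes x :: "real^'n"
  assumes f': "\<And>r. r \<ge> 0 \<Longrightarrow> (f has_real_derivative f' r) (at r within {0..})"
    and f'': "\<And>r. r \<ge> 0 \<Longrightarrow> (f' has_real_derivative f'' r) (at r within {0..})"
    and "x \<noteq> 0"
  shows differentiable_radial: "(\<lambda>y. f (norm y)) differentiable at x"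
    and differentiable_grad_radial: "grad (\<lambda>y. f (norm y)) differentiable at x"
proof -
  \<comment> \<open>The derivatives of \<open>f\<close> are one-sided only at the endpoint 0; away
    from the origin the norm is positive and they are ordinary derivatives.\<close>
  have at: "at (norm y) within {0..} = at (norm y)" if "y \<noteq> 0" for y :: "real^'n"
    using that by (intro at_within_interior) (simp add: interior_real_atLeast)
  have norm: "(norm has_derivative (\<lambda>v. sgn y \<bullet> v)) (at y)" if "y \<noteq> 0" for y :: "real^'n"
    using that has_derivative_norm[OF that] by (simp add: inner_commute)
  have rad: "((\<lambda>y. f (norm y)) has_derivative (\<lambda>v. f' (norm y) * (sgn y \<bullet> v))) (at y)"
    if "y \<noteq> 0" for y :: "real^'n"
    using has_derivative_compose[OF norm[OF that], of f "\<lambda>v. f' (norm y) * v"] f'[of "norm y"] at[OF that]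
    by (simp add: has_field_derivative_def)
  show "(\<lambda>y. f (norm y)) differentiable at x"
    using rad[OF \<open>x \<noteq> 0\<close>] by (auto simp: differentiable_def)
  have "f' differentiable at (norm x)"
    using f''[of "norm x"] at[OF \<open>x \<noteq> 0\<close>] by (auto simp: real_differentiable_def)
  then have f'_norm: "(\<lambda>y. f' (norm y)) differentiable at x"
    using differentiable_compose[of f' norm x UNIV] \<open>x \<noteq> 0\<close> by simp
  \<comment> \<open>This field is the gradient of f(|y|) for y \<noteq> 0, as verified below. Its
    differentiability needs \<open>f'\<close> to be differentiable, which is where
    \<open>f''\<close> enters.\<close>
  have "(\<lambda>y. (f' (norm y) * inverse (norm y)) *\<^sub>R y) differentiable at x"
    using f'_norm \<open>x \<noteq> 0\<close> by (intro differentiable_scaleR differentiable_mult differentiable_inverse) auto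
  then obtain D where D: "((\<lambda>y. (f' (norm y) * inverse (norm y)) *\<^sub>R y) has_derivative D) (at x)"
    by (auto simp: differentiable_def)
  have "(grad (\<lambda>y. f (norm y)) has_derivative D) (at x)"
  proof (rule has_derivative_transform_within_open[OF D, of "- {0}"])
    fix y :: "real^'n" assume "y \<in> - {0}"
    then show "(f' (norm y) * inverse (norm y)) *\<^sub>R y = grad (\<lambda>y. f (norm y)) y"
      using frechet_derivative_at[OF rad[of y], symmetric]
      by (simp add: grad_def vec_eq_iff inner_axis sgn_div_norm)
  qed (use \<open>x \<noteq> 0\<close> in auto)
  then show "grad (\<lambda>y. f (norm y)) differentiable at x"
    by (auto simp: differentiable_def)
qed

lemma admissible_radial_cmult:
  assumes f: "f \<in> admissible_radial TYPE('n::finite) p q" and "c > 0"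
  shows "(\<lambda>r. c * f r) \<in> admissible_radial TYPE('n) p q"
proof -
  obtain f' f'' where f':
      "\<And>r. r \<ge> 0 \<Longrightarrow> (f has_real_derivative f' r) (at r within {0..})"
      "\<And>r. r \<ge> 0 \<Longrightarrow> (f' has_real_derivative f'' r) (at r within {0..})"
    and cont: "continuous_on {0..} f''" and zero: "f 0 = 0" "f' 0 = 0" "f'' 0 = 0"
    and pos: "\<And>r. r > 0 \<Longrightarrow> f'' r > 0"
    and lim: "((\<lambda>x::real^'n. F_pq p q (grad (\<lambda>y. f (norm y)) x) (hess (\<lambda>y. f (norm y)) x))
        \<longlongrightarrow> 0) (at 0)"
    using f unfolding admissible_radial_def by blast
  \<comment> \<open>A limit at 0 ignores the value at 0, so it suffices to scale the operator on the
    punctured space, where the radial function is regular enough for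
    \<open>hess_cmult\<close>.\<close>
  have "F_pq p q (grad (\<lambda>y. c * f (norm y)) x) (hess (\<lambda>y. c * f (norm y)) x)
      = c powr (q - 1) * F_pq p q (grad (\<lambda>y. f (norm y)) x) (hess (\<lambda>y. f (norm y)) x)"
    if "x \<noteq> 0" for x :: "real^'n"
  proof -
    have "hess (\<lambda>y. c * f (norm y)) x = c *\<^sub>R hess (\<lambda>y. f (norm y)) x"
      using that differentiable_radial[OF f'] differentiable_grad_radial[OF f']
      by (intro hess_cmult[of "- {0}"]) auto
    then show ?thesis
      using grad_cmult[OF differentiable_radial[OF f' that], of c] \<open>c > 0\<close>
      by (simp add: F_pq_homogeneous)
  qed
  moreover have "((\<lambda>x::real^'n. c powr (q - 1) *
      F_pq p q (grad (\<lambda>y. f (norm y)) x) (hess (\<lambda>y. f (norm y)) x)) \<longlongrightarrow> 0) (at 0)"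
    using tendsto_mult_right_zero[OF lim] .
  ultimately have "((\<lambda>x::real^'n. F_pq p q (grad (\<lambda>y. c * f (norm y)) x) (hess (\<lambda>y. c * f (norm y)) x))
      \<longlongrightarrow> 0) (at 0)"
    by (simp add: eventually_at_filter cong: Lim_cong_within)
  moreover have "\<forall>r\<ge>0. ((\<lambda>r. c * f r) has_real_derivative c * f' r) (at r within {0..})"
    "\<forall>r\<ge>0. ((\<lambda>r. c * f' r) has_real_derivative c * f'' r) (at r within {0..})"
    using f' by (auto intro: DERIV_cmult)
  moreover have "continuous_on {0..} (\<lambda>r. c * f'' r)"
    using cont by (intro continuous_intros)
  ultimately show ?thesis
    unfolding admissible_radial_def mem_Collect_eq
    using zero pos \<open>c > 0\<close>
    by (intro exI[of _ "\<lambda>r. c * f' r"] exI[of _ "\<lambda>r. c * f'' r"]) simp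
qed

lemma admissible_time_cmult:
  assumes "\<sigma> \<in> admissible_time" "c > 0"
  shows "(\<lambda>r. c * \<sigma> r) \<in> admissible_time"
proof -
  obtain D where D: "\<And>r. (\<sigma> has_real_derivative D r) (at r)" "continuous_on UNIV D"
    using assms by (auto simp: admissible_time_def C1_differentiable_on_def
        has_real_derivative_iff_has_vector_derivative)
  have D': "((\<lambda>r. c * \<sigma> r) has_real_derivative c * D r) (at r)" for r
    using D by (intro DERIV_cmult)
  have "D 0 = 0"
    using assms DERIV_imp_deriv[OF D(1)[of 0]] by (simp add: admissible_time_def)
  then have "deriv (\<lambda>r. c * \<sigma> r) 0 = 0"
    using DERIV_imp_deriv[OF D'[of 0]] by simp
  moreover have "(\<lambda>r. c * \<sigma> r) C1_differentiable_on UNIV"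
    using D D' unfolding C1_differentiable_on_def
    by (auto simp: has_real_derivative_iff_has_vector_derivative[symmetric]
        intro!: exI[of _ "\<lambda>r. c * D r"] continuous_intros)
  ultimately show ?thesis
    using assms by (simp add: admissible_time_def)
qed

text \<open>A nonzero gradient stays nonzero. If the gradient vanishes, the remainder after the
  affine part in time is multiplied by \<open>c\<close>, so the same cylinder works with
  \<open>c * f\<close> and \<open>c * \<sigma>\<close> as bounds.\<close>

lemma admissible_at_cmult:
  fixes \<phi> :: "(real^'n) \<times> real \<Rightarrow> real"
  assumes "admissible_at p q \<Theta> \<phi> \<xi>" and \<phi>: "C2_on \<Theta> \<phi>" "open \<Theta>" "\<xi> \<in> \<Theta>" and "c > 0"
  shows "admissible_at p q \<Theta> (\<lambda>\<eta>. c * \<phi> \<eta>) \<xi>"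
proof (cases "grad_x \<phi> \<xi> = 0")
  case False
  then show ?thesis
    using grad_x_cmult[OF \<phi>] \<open>c > 0\<close> by (simp add: admissible_at_def)
next
  case True
  then obtain \<delta> f \<sigma> where "\<delta> > 0" and f: "f \<in> admissible_radial TYPE('n) p q"
    and \<sigma>: "\<sigma> \<in> admissible_time"
    and sub: "ball (fst \<xi>) \<delta> \<times> {snd \<xi> - \<delta><..<snd \<xi> + \<delta>} \<subseteq> \<Theta>"
    and bound: "\<And>x t. x \<in> ball (fst \<xi>) \<delta> \<Longrightarrow> t \<in> {snd \<xi> - \<delta><..<snd \<xi> + \<delta>} \<Longrightarrow>
           \<bar>\<phi> (x, t) - \<phi> \<xi> - deriv_t \<phi> \<xi> * (t - snd \<xi>)\<bar> \<le> f (norm (x - fst \<xi>)) + \<sigma> (t - snd \<xi>)"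
    using assms(1) unfolding admissible_at_def by blast
  have "\<bar>c * \<phi> (x, t) - c * \<phi> \<xi> - deriv_t (\<lambda>\<eta>. c * \<phi> \<eta>) \<xi> * (t - snd \<xi>)\<bar>
      \<le> c * f (norm (x - fst \<xi>)) + c * \<sigma> (t - snd \<xi>)"
    if "x \<in> ball (fst \<xi>) \<delta>" "t \<in> {snd \<xi> - \<delta><..<snd \<xi> + \<delta>}" for x t
  proof -
    have "c * \<phi> (x, t) - c * \<phi> \<xi> - deriv_t (\<lambda>\<eta>. c * \<phi> \<eta>) \<xi> * (t - snd \<xi>)
        = c * (\<phi> (x, t) - \<phi> \<xi> - deriv_t \<phi> \<xi> * (t - snd \<xi>))"
      by (simp add: deriv_t_cmult[OF \<phi>] algebra_simps)
    then show ?thesis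
      using mult_left_mono[OF bound[OF that], of c] \<open>c > 0\<close> by (simp add: abs_mult distrib_left)
  qed
  then show ?thesis
    using \<open>\<delta> > 0\<close> sub admissible_radial_cmult[OF f \<open>c > 0\<close>] admissible_time_cmult[OF \<sigma> \<open>c > 0\<close>]
    unfolding admissible_at_def
    by (intro disjI2 exI[of _ \<delta>] conjI bexI[of _ "\<lambda>r. c * f r"] bexI[of _ "\<lambda>r. c * \<sigma> r"] ballI)
qed

section \<open>Scaling of supersolutions and Perron solutions\<close>

lemma Liminf_cmult_ereal:
  fixes u :: "'a \<Rightarrow> ereal"
  assumes "c > (0::real)"
  shows "Liminf F (\<lambda>x. ereal c * u x) = ereal c * Liminf F u"
\<comment> \<open>Over the trivial filter every \<open>Liminf\<close> is infinite, and a positive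
  factor preserves infinity; the product rule is applied to nontrivial filters.\<close>
proof (cases "F = bot")
  case True
  then have "Liminf F v = \<infinity>" for v :: "'a \<Rightarrow> ereal"
    by (simp flip: top_ereal_def)
  then show ?thesis
    using assms by simp
next
  case False
  then show ?thesis
    using assms by (simp add: Liminf_ereal_mult_left)
qed

lemma INF_cmult_ereal:
  fixes u :: "'a \<Rightarrow> ereal"
  assumes "c > (0::real)"
  shows "(INF x\<in>A. ereal c * u x) = ereal c * (INF x\<in>A. u x)"
proof -
  have "(\<lambda>x. ereal c * u x) ` A = {ereal c * y |y. y \<in> u ` A}"
    by auto
  then show ?thesis
    using ereal_Inf_cmult[OF assms, of "\<lambda>y. y \<in> u ` A"] by simp
qed

lemma ereal_cmult_cancel:
  assumes "c * d = (1::real)"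
  shows "ereal c * (ereal d * x) = x"
proof -
  have "ereal c * (ereal d * x) = ereal (c * d) * x"
    by (simp flip: mult.assoc)
  then show ?thesis
    using assms by simp
qed

section \<open>Contact from below and supersolutions\<close>

lemma touches_from_below_cmult:
  assumes "touches_from_below S \<phi> u \<xi>" "c > 0"
  shows "touches_from_below S (\<lambda>\<eta>. c * \<phi> \<eta>) (\<lambda>\<eta>. ereal c * u \<eta>) \<xi>"
proof -
  have "ereal (c * \<phi> \<eta>) < ereal c * u \<eta>" if "ereal (\<phi> \<eta>) < u \<eta>" for \<eta>
    using ereal_mult_strict_left_mono[OF that, of "ereal c"] \<open>c > 0\<close> by simp
  moreover have "ereal (c * \<phi> \<xi>) = ereal c * u \<xi>"
    using assms by (simp add: touches_from_below_def flip: times_ereal.simps(1))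
  ultimately show ?thesis
    using assms unfolding touches_from_below_def by (auto elim: eventually_mono)
qed

text \<open>If \<phi> touches \<open>c * u\<close> from below, then \<phi> / c touches
  \<open>u\<close> and is again admissible. The inequality for \<phi> / c, multiplied by
  \<open>c powr (q - 1)\<close>, is the one required of \<phi>. Where the gradient vanishes, only
  the sign of the time derivative matters, and \<open>c > 0\<close> preserves it.\<close>

lemma viscosity_supersolution_cmult:
  fixes u :: "(real^'n) \<times> real \<Rightarrow> ereal"
  assumes u: "viscosity_supersolution a p q \<Theta> u" and "open \<Theta>" and "c > 0"
  shows "viscosity_supersolution (a * c powr (q - 2)) p q \<Theta> (\<lambda>\<xi>. ereal c * u \<xi>)"
  unfolding viscosity_supersolution_def
proof (intro conjI ballI allI impI)
  show "ereal c * u \<xi> \<noteq> -\<infinity>" if "\<xi> \<in> \<Theta>" for \<xi>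
    using u \<open>c > 0\<close> that by (cases "u \<xi>") (auto simp: viscosity_supersolution_def)
  have "ereal c * u \<xi> \<le> ereal c * Liminf (at \<xi> within \<Theta>) u" if "\<xi> \<in> \<Theta>" for \<xi>
    using u that \<open>c > 0\<close>
    by (intro ereal_mult_left_mono) (auto simp: viscosity_supersolution_def lower_semicontinuous_on_def)
  then show "lower_semicontinuous_on \<Theta> (\<lambda>\<xi>. ereal c * u \<xi>)"
    using \<open>c > 0\<close> by (simp add: lower_semicontinuous_on_def Liminf_cmult_ereal)
  have "ereal c * u \<xi> \<noteq> \<infinity> \<longleftrightarrow> u \<xi> \<noteq> \<infinity>" for \<xi>
    using \<open>c > 0\<close> by (cases "u \<xi>") auto
  then show "\<Theta> \<subseteq> closure {\<xi> \<in> \<Theta>. ereal c * u \<xi> \<noteq> \<infinity>}"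
    using u by (simp add: viscosity_supersolution_def)
next
  fix \<phi> \<xi>
  assume \<xi>: "\<xi> \<in> \<Theta>" and *: "C2_on \<Theta> \<phi> \<and> admissible_at p q \<Theta> \<phi> \<xi> \<and>
    touches_from_below \<Theta> \<phi> (\<lambda>\<xi>. ereal c * u \<xi>) \<xi>"
  define d where "d = inverse c"
  have d: "d > 0" "d * c = 1"
    using \<open>c > 0\<close> by (auto simp: d_def)
  note \<phi> = conjunct1[OF *] \<open>open \<Theta>\<close> \<xi>
  let ?\<psi> = "\<lambda>\<eta>. d * \<phi> \<eta>"
  have "touches_from_below \<Theta> ?\<psi> u \<xi>"
    using touches_from_below_cmult[of \<Theta> \<phi> _ \<xi> d] * d by (fastforce simp: ereal_cmult_cancel)
  moreover have "C2_on \<Theta> ?\<psi>" "admissible_at p q \<Theta> ?\<psi> \<xi>"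
    using * d \<phi> by (auto intro: C2_on_cmult admissible_at_cmult)
  ultimately have super: "if grad_x ?\<psi> \<xi> \<noteq> 0 then a * deriv_t ?\<psi> \<xi> - Delta_pq p q ?\<psi> \<xi> \<ge> 0
      else deriv_t ?\<psi> \<xi> \<ge> 0"
    using u \<xi> unfolding viscosity_supersolution_def by blast
  show "if grad_x \<phi> \<xi> \<noteq> 0 then a * c powr (q - 2) * deriv_t \<phi> \<xi> - Delta_pq p q \<phi> \<xi> \<ge> 0
      else deriv_t \<phi> \<xi> \<ge> 0"
  proof (cases "grad_x \<phi> \<xi> = 0")
    case True
    then show ?thesis
      using super d by (simp add: grad_x_cmult[OF \<phi>] deriv_t_cmult[OF \<phi>] zero_le_mult_iff)
  next
    case False
    \<comment> \<open>Splitting off one factor gives d * (d * c)^(q-2), and d * c = 1. This makes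
      the coefficient of the time derivative match after \<open>d powr (q - 1)\<close> is factored
      out.\<close>
    have "d powr (q - 1) * c powr (q - 2) = d"
      using d \<open>c > 0\<close> powr_add[of d "q - 2" 1] powr_mult[of d c "q - 2"]
      by (simp add: algebra_simps)
    then have "a * deriv_t ?\<psi> \<xi> - Delta_pq p q ?\<psi> \<xi>
        = d powr (q - 1) * (a * c powr (q - 2) * deriv_t \<phi> \<xi> - Delta_pq p q \<phi> \<xi>)"
      using d by (simp add: deriv_t_cmult[OF \<phi>] Delta_pq_cmult[OF \<phi>] algebra_simps)
    then show ?thesis
      using super False d by (simp add: grad_x_cmult[OF \<phi>] zero_le_mult_iff)
  qed
qed

section \<open>Upper classes, Perron solutions and regularity\<close>

lemma upper_class_cmult:
  fixes u :: "(real^'n) \<times> real \<Rightarrow> ereal"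
  assumes u: "u \<in> upper_class a p q \<Theta> f" and "open \<Theta>" and "c > 0"
  shows "(\<lambda>\<xi>. ereal c * u \<xi>) \<in> upper_class (a * c powr (q - 2)) p q \<Theta> (\<lambda>\<xi>. c * f \<xi>)"
proof -
  have le: "ereal (c * r) \<le> ereal c * x" if "ereal r \<le> x" for r x
    using ereal_mult_left_mono[OF that, of "ereal c"] \<open>c > 0\<close> by simp
  obtain m where "\<And>\<xi>. \<xi> \<in> \<Theta> \<Longrightarrow> ereal m \<le> u \<xi>"
    using u by (auto simp: upper_class_def)
  then have "\<exists>m::real. \<forall>\<xi>\<in>\<Theta>. ereal m \<le> ereal c * u \<xi>"
    using le by blast
  then show ?thesis
    using u \<open>c > 0\<close> viscosity_supersolution_cmult[OF _ \<open>open \<Theta>\<close> \<open>c > 0\<close>, of a p q u] le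
    by (simp add: upper_class_def Liminf_cmult_ereal)
qed

text \<open>Multiplication by \<open>c\<close> maps one upper class onto the other, with
  multiplication by \<open>inverse c\<close> as its inverse; a positive finite factor then commutes
  with the infimum.\<close>

lemma upper_perron_cmult:
  fixes \<Theta> :: "((real^'n) \<times> real) set"
  assumes "open \<Theta>" and "c > 0"
  shows "upper_perron (a * c powr (q - 2)) p q \<Theta> (\<lambda>\<xi>. c * f \<xi>) \<xi>
    = ereal c * upper_perron a p q \<Theta> f \<xi>"
proof -
  let ?U = "upper_class a p q \<Theta> f"
  let ?V = "upper_class (a * c powr (q - 2)) p q \<Theta> (\<lambda>\<xi>. c * f \<xi>)"
  let ?s = "\<lambda>c u \<eta>. ereal c * u \<eta>"
  define d where "d = inverse c"
  have d: "d > 0" "d * c = 1" "c * d = 1"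
    using \<open>c > 0\<close> by (auto simp: d_def)
  have "c powr (q - 2) * d powr (q - 2) = 1"
    using d \<open>c > 0\<close> powr_mult[of c d "q - 2"] by simp
  moreover have "(\<lambda>\<xi>. d * (c * f \<xi>)) = f"
    using d(2) by (simp flip: mult.assoc)
  \<comment> \<open>Scaling by \<open>d\<close> multiplies the coefficient by
    \<open>d powr (q - 2)\<close>, which restores \<open>a\<close>, and turns the data
    \<open>c * f\<close> back into \<open>f\<close>.\<close>
  ultimately have inverse: "?s d v \<in> ?U" if "v \<in> ?V" for v
    using upper_class_cmult[OF that \<open>open \<Theta>\<close> \<open>d > 0\<close>]
    by (simp add: mult.assoc)
  have "?V = ?s c ` ?U"
  proof (intro equalityI subsetI)
    fix v assume "v \<in> ?V"
    moreover have "v = ?s c (?s d v)"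
      by (simp add: ereal_cmult_cancel[OF d(3)])
    ultimately show "v \<in> ?s c ` ?U"
      by (intro image_eqI[OF _ inverse])
  qed (auto intro: upper_class_cmult[OF _ assms])
  then have "upper_perron (a * c powr (q - 2)) p q \<Theta> (\<lambda>\<xi>. c * f \<xi>) \<xi> = (INF u\<in>?U. ereal c * u \<xi>)"
    by (simp add: upper_perron_def image_image)
  then show ?thesis
    by (simp only: INF_cmult_ereal[OF \<open>c > 0\<close>] upper_perron_def)
qed

text \<open>Regularity quantifies over all continuous boundary data, a class closed under division
  by \<open>c\<close>. Applying it to \<open>f / c\<close> and multiplying the limit by
  \<open>c\<close> gives the limit for \<open>f\<close>.\<close>

lemma regular_boundary_point_cmult:
  fixes \<Theta> :: "((real^'n) \<times> real) set"
  assumes reg: "regular_boundary_point a p q \<Theta> \<xi>\<^sub>0" and "open \<Theta>" and "c > 0"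
  shows "regular_boundary_point (a * c powr (q - 2)) p q \<Theta> \<xi>\<^sub>0"
  unfolding regular_boundary_point_def
proof (intro conjI allI impI)
  show "\<xi>\<^sub>0 \<in> frontier \<Theta>"
    using reg by (simp add: regular_boundary_point_def)
next
  fix f :: "(real^'n) \<times> real \<Rightarrow> real"
  assume "continuous_on (frontier \<Theta>) f"
  then have "continuous_on (frontier \<Theta>) (\<lambda>\<xi>. f \<xi> / c)"
    using \<open>c > 0\<close> by (intro continuous_intros) auto
  then have "(upper_perron a p q \<Theta> (\<lambda>\<xi>. f \<xi> / c) \<longlongrightarrow> ereal (f \<xi>\<^sub>0 / c)) (at \<xi>\<^sub>0 within \<Theta>)"
    using reg unfolding regular_boundary_point_def by blast
  then have "((\<lambda>\<xi>. ereal c * upper_perron a p q \<Theta> (\<lambda>\<xi>. f \<xi> / c) \<xi>)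
      \<longlongrightarrow> ereal c * ereal (f \<xi>\<^sub>0 / c)) (at \<xi>\<^sub>0 within \<Theta>)"
    by (intro tendsto_cmult_ereal) auto
  moreover have "upper_perron (a * c powr (q - 2)) p q \<Theta> f
      = (\<lambda>\<xi>. ereal c * upper_perron a p q \<Theta> (\<lambda>\<xi>. f \<xi> / c) \<xi>)"
    using upper_perron_cmult[OF \<open>open \<Theta>\<close> \<open>c > 0\<close>, of a q p "\<lambda>\<xi>. f \<xi> / c"] \<open>c > 0\<close>
    by (simp add: fun_eq_iff)
  ultimately show "(upper_perron (a * c powr (q - 2)) p q \<Theta> f \<longlongrightarrow> ereal (f \<xi>\<^sub>0)) (at \<xi>\<^sub>0 within \<Theta>)"
    using \<open>c > 0\<close> by simp
qed

theorem theorem6p3: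
  fixes p q a :: real and \<Theta> :: "((real^'n) \<times> real) set" and \<xi>\<^sub>0 :: "(real^'n) \<times> real"
  assumes "p > 1" and "q > 1" and "q \<noteq> 2"
    and "open \<Theta>" and "bounded \<Theta>" and "\<xi>\<^sub>0 \<in> frontier \<Theta>" and "a > 0"
  shows "regular_boundary_point 1 p q \<Theta> \<xi>\<^sub>0 \<longleftrightarrow> regular_boundary_point a p q \<Theta> \<xi>\<^sub>0"
proof
  \<comment> \<open>The solution of c^(q-2) = a; the exponent makes sense because q \<noteq> 2.
    Scaling by this \<open>c\<close> takes coefficient 1 to coefficient \<open>a\<close>.\<close>
  define c where "c = a powr (1 / (q - 2))"
  have c: "c > 0" "c powr (q - 2) = a"
    using \<open>a > 0\<close> \<open>q \<noteq> 2\<close> by (auto simp: c_def powr_powr)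
  show "regular_boundary_point a p q \<Theta> \<xi>\<^sub>0" if "regular_boundary_point 1 p q \<Theta> \<xi>\<^sub>0"
    using regular_boundary_point_cmult[OF that \<open>open \<Theta>\<close> \<open>c > 0\<close>] c by simp
  \<comment> \<open>The converse scales by the reciprocal, which takes coefficient \<open>a\<close>
    back to 1.\<close>
  have "a * inverse c powr (q - 2) = 1"
    using c \<open>a > 0\<close> by (simp add: inverse_powr)
  then show "regular_boundary_point 1 p q \<Theta> \<xi>\<^sub>0" if "regular_boundary_point a p q \<Theta> \<xi>\<^sub>0"
    using regular_boundary_point_cmult[OF that \<open>open \<Theta>\<close>, of "inverse c"] c by simp
qed

end
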